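(* Let $ABC$ be a scalene triangle with first Fermat point $F_1$ and second Fermat point $F_2$, and let $\mathcal{K}$ be its Kiepert hyperbola, i.e. the unique conic passing through the five points $A,B,C,F_1,F_2$. Let $\mathcal{C}$ be the circle centered at $F_2$ with radius $F_2F_1$, and let $\mathcal{C}'$ be the circle centered at $F_1$ with radius $F_2F_1$. Let $P,Q,R$ be the three points other than $F_1$ at which $\mathcal{C}$ intersects $\mathcal{K}$, and let $P',Q',R'$ be the three points other than $F_2$ at which $\mathcal{C}'$ intersects $\mathcal{K}$. Then, with $P,Q,R$ and $P',Q',R'$ each labelled in a suitable order (clockwise or counterclockwise), the following hold. (a) The triangles $PQR$ and $P'Q'R'$ are equilateral. (b) The triangle $PQR$ is triply perspective to $ABC$: the lines $PA,QB,RC$ meet at a common point $P_1$; the lines $PB,QC,RA$ meet at a common point $P_2$; and the lines $PC,QA,RB$ meet at a common point $P_3$. Likewise the triangle $P'R'Q'$ (vertices taken in this order) is triply perspective to $ABC$: the lines $P'A,R'B,Q'C$ meet at a common point $P_1'$; the lines $P'B,R'C,Q'A$ meet at a common point $P_2'$; and the lines $P'C,R'A,Q'B$ meet at a common point $P_3'$. (c) The three perspectors $P_1,P_2,P_3$ are collinear, on a line which also passes through the three perspectors $P_1',P_2',P_3'$.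
   Context: All points lie in the real Euclidean plane; concurrency and collinearity are understood in its projective completion (so a common point of lines may be a point at infinity). The first Fermat point $F_1$ of a triangle is obtained by erecting an equilateral triangle outwardly on each side of the triangle: the three lines joining the outer vertex of each equilateral triangle to the opposite vertex of the original triangle concur at $F_1$. The second Fermat point $F_2$ is obtained in the same way with the equilateral triangles erected inwardly on each side. The Kiepert hyperbola of a scalene triangle $ABC$ is the unique conic through the five points $A,B,C,F_1,F_2$ (in particular these are five distinct points); $ABC$ is called its reference triangle.
   Formalization: It is assumed that each circle meets the Kiepert hyperbola in exactly three points other than F_1 (respectively F_2); this fails only when the circles are tangent to the hyperbola at the Fermat points, where only two other points exist. *)

theory Defs
  imports "HOL-Analysis.Analysis"
begin

section \<open>Triangles in the Euclidean plane\<close>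

definition scalene_triangle :: "real^2 \<Rightarrow> real^2 \<Rightarrow> real^2 \<Rightarrow> bool" where
  "scalene_triangle A B C \<longleftrightarrow> \<not> collinear {A, B, C} \<and>
     dist A B \<noteq> dist B C \<and> dist B C \<noteq> dist C A \<and> dist C A \<noteq> dist A B"

definition equilateral_triangle :: "real^2 \<Rightarrow> real^2 \<Rightarrow> real^2 \<Rightarrow> bool" where
  "equilateral_triangle P Q R \<longleftrightarrow> \<not> collinear {P, Q, R} \<and>
     dist P Q = dist Q R \<and> dist Q R = dist R P"

definition opposite_sides :: "real^2 \<Rightarrow> real^2 \<Rightarrow> real^2 \<Rightarrow> real^2 \<Rightarrow> bool" where
  "opposite_sides B C X Y \<longleftrightarrow>
     X \<notin> affine hull {B, C} \<and> Y \<notin> affine hull {B, C} \<and>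
     closed_segment X Y \<inter> affine hull {B, C} \<noteq> {}"

definition same_side :: "real^2 \<Rightarrow> real^2 \<Rightarrow> real^2 \<Rightarrow> real^2 \<Rightarrow> bool" where
  "same_side B C X Y \<longleftrightarrow> closed_segment X Y \<inter> affine hull {B, C} = {}"

text \<open>
  In the next two definitions \<open>X\<close> is the apex of the equilateral triangle erected on the side
  \<open>BC\<close> of the triangle \<open>ABC\<close>, outwardly or inwardly.
\<close>

definition outer_apex :: "real^2 \<Rightarrow> real^2 \<Rightarrow> real^2 \<Rightarrow> real^2 \<Rightarrow> bool" where
  "outer_apex A B C X \<longleftrightarrow> equilateral_triangle X B C \<and> opposite_sides B C A X"

definition inner_apex :: "real^2 \<Rightarrow> real^2 \<Rightarrow> real^2 \<Rightarrow> real^2 \<Rightarrow> bool" where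
  "inner_apex A B C X \<longleftrightarrow> equilateral_triangle X B C \<and> same_side B C A X"

text \<open>
  For a scalene triangle each apex differs from the opposite vertex and the three lines always
  meet in one point of the affine plane, so restricting to affine lines loses nothing.
\<close>

definition first_fermat_point :: "real^2 \<Rightarrow> real^2 \<Rightarrow> real^2 \<Rightarrow> real^2 \<Rightarrow> bool" where
  "first_fermat_point A B C F \<longleftrightarrow>
     (\<exists>X Y Z. outer_apex A B C X \<and> outer_apex B C A Y \<and> outer_apex C A B Z \<and>
        F \<in> affine hull {A, X} \<and> F \<in> affine hull {B, Y} \<and> F \<in> affine hull {C, Z})"

definition second_fermat_point :: "real^2 \<Rightarrow> real^2 \<Rightarrow> real^2 \<Rightarrow> real^2 \<Rightarrow> bool" where
  "second_fermat_point A B C F \<longleftrightarrow>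
     (\<exists>X Y Z. inner_apex A B C X \<and> inner_apex B C A Y \<and> inner_apex C A B Z \<and>
        F \<in> affine hull {A, X} \<and> F \<in> affine hull {B, Y} \<and> F \<in> affine hull {C, Z})"

section \<open>Conics\<close>

definition conic :: "(real^2) set \<Rightarrow> bool" where
  "conic K \<longleftrightarrow>
     (\<exists>a b c d e f. (a, b, c) \<noteq> (0, 0, 0) \<and>
        K = {X. a * (X$1)\<^sup>2 + b * (X$1) * (X$2) + c * (X$2)\<^sup>2 + d * (X$1) + e * (X$2) + f = 0})"

text \<open>
  Uniqueness of the conic is not part of the definition; for a scalene triangle it is a
  consequence of the five points being distinct.
\<close>

definition kiepert_hyperbola ::
    "real^2 \<Rightarrow> real^2 \<Rightarrow> real^2 \<Rightarrow> real^2 \<Rightarrow> real^2 \<Rightarrow> (real^2) set \<Rightarrow> bool" where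
  "kiepert_hyperbola A B C F\<^sub>1 F\<^sub>2 K \<longleftrightarrow>
     first_fermat_point A B C F\<^sub>1 \<and> second_fermat_point A B C F\<^sub>2 \<and>
     distinct [A, B, C, F\<^sub>1, F\<^sub>2] \<and> conic K \<and> {A, B, C, F\<^sub>1, F\<^sub>2} \<subseteq> K"

section \<open>The projective completion of the plane\<close>

text \<open>
  Points and lines of the projective completion are the one- and two-dimensional subspaces of
  three-dimensional space, incidence is inclusion, and the affine point \<open>(x, y)\<close> is the span
  of \<open>(x, y, 1)\<close>.
\<close>

definition proj_point :: "(real^3) set \<Rightarrow> bool" where
  "proj_point X \<longleftrightarrow> subspace X \<and> dim X = 1"

definition proj_line :: "(real^3) set \<Rightarrow> bool" where
  "proj_line L \<longleftrightarrow> subspace L \<and> dim L = 2"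

definition homogeneous :: "real^2 \<Rightarrow> real^3" where
  "homogeneous P = vector [P$1, P$2, 1]"

text \<open>The line joining \<open>P\<close> and \<open>Q\<close>; this is a projective line only for \<open>P \<noteq> Q\<close>.\<close>

definition join_line :: "real^2 \<Rightarrow> real^2 \<Rightarrow> (real^3) set" where
  "join_line P Q = span {homogeneous P, homogeneous Q}"

text \<open>\<open>X\<close> is a common point of the lines \<open>PA\<close>, \<open>QB\<close>, \<open>RC\<close>.\<close>

definition perspector ::
    "real^2 \<Rightarrow> real^2 \<Rightarrow> real^2 \<Rightarrow> real^2 \<Rightarrow> real^2 \<Rightarrow> real^2 \<Rightarrow> (real^3) set \<Rightarrow> bool" where
  "perspector P Q R A B C X \<longleftrightarrow>
     P \<noteq> A \<and> Q \<noteq> B \<and> R \<noteq> C \<and> proj_point X \<and>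
     X \<subseteq> join_line P A \<and> X \<subseteq> join_line Q B \<and> X \<subseteq> join_line R C"

end

theory Submission
  imports Defs "HOL-Computational_Algebra.Polynomial"
begin

text \<open>
  From a Fermat point the vertices are seen along three lines at 60 degrees to each other, and the
  two Fermat points see them in opposite senses. Hence the sum of the directions of \<open>F\<^sub>1X\<close> and \<open>F\<^sub>2X\<close>
  is the same for \<open>X = A, B, C\<close>, which puts the three vertices on a rectangular hyperbola with
  antipodal points \<open>F\<^sub>1\<close>, \<open>F\<^sub>2\<close>. In coordinates along the asymptotes, centred at the midpoint of
  \<open>F\<^sub>1F\<^sub>2\<close> and with \<open>F\<^sub>1 = (f, g)\<close>, its points are \<open>(g a, f / a)\<close>; the points \<open>F\<^sub>1\<close>, \<open>F\<^sub>2\<close> have the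
  parameters \<open>\<plusminus> f / g\<close>, and the vertices have parameters \<open>tan \<theta>\<close> for three angles at 60 degrees
  steps. Such triples are the roots of \<open>x\<^sup>3 + 3 k x\<^sup>2 - 3 x - k\<close>, where \<open>k\<close> is their product.

  Intersecting with the circles gives exactly the triples with \<open>k = \<plusminus> f / g\<close>, and these are the
  equilateral ones. If two triples \<open>tan (\<phi> + 60 i)\<close> and \<open>tan (\<theta> - 60 i)\<close> run in opposite senses,
  the sum of corresponding angles is constant, so corresponding points are paired by an involution
  of the conic and the chords concur. The common point for angle sum \<open>\<sigma>\<close> is
  \<open>(g tan \<sigma>, - f tan \<sigma>)\<close>, on a fixed line through the centre.
\<close>

section \<open>Triples of tangents in arithmetic progression\<close>

text \<open>With \<open>s = tan \<delta>\<close>, the first equation says that \<open>b = tan (\<phi> + \<delta>)\<close> if \<open>a = tan \<phi>\<close>;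
  closing up after three steps forces \<open>s = \<plusminus> sqrt 3\<close>.\<close>

definition tan_triple :: "real \<Rightarrow> real \<Rightarrow> real \<Rightarrow> real \<Rightarrow> bool" where
  "tan_triple s a b c \<longleftrightarrow> b - a = s * (1 + a * b) \<and> c - b = s * (1 + b * c) \<and> a - c = s * (1 + c * a)"

lemma tan_triple_rotate: "tan_triple s a b c \<Longrightarrow> tan_triple s b c a"
  by (auto simp: tan_triple_def)

lemma tan_triple_distinct:
  assumes "tan_triple s a b c" "s \<noteq> 0"
  shows "a \<noteq> b" "b \<noteq> c" "c \<noteq> a"
proof -
  have "1 + x * x \<noteq> 0" for x :: real
    by (smt (verit) zero_le_square)
  then show "a \<noteq> b" "b \<noteq> c" "c \<noteq> a"
    using assms by (auto simp: tan_triple_def)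
qed

text \<open>The left-hand sides cancel both when the three equations are added and when they are
  added with weights \<open>c\<close>, \<open>a\<close>, \<open>b\<close>; the factor
  \<open>s\<close> is then divided out.\<close>

lemma tan_triple_symmetric_functions:
  assumes "tan_triple s a b c" "s \<noteq> 0"
  shows "a * b + b * c + c * a = -3" "a + b + c = -3 * (a * b * c)"
proof -
  have eqs: "b - a = s * (1 + a * b)" "c - b = s * (1 + b * c)" "a - c = s * (1 + c * a)"
    using assms by (auto simp: tan_triple_def)
  have "s * (3 + (a * b + b * c + c * a)) = 0"
    using eqs by algebra
  then show "a * b + b * c + c * a = -3" using assms by simp
  have "s * (a + b + c + 3 * (a * b * c)) = 0"
    using eqs by algebra
  then show "a + b + c = -3 * (a * b * c)" using assms by simp
qed

text \<open>Vieta. For \<open>x\<close> the tangent of an angle, the cubic is the triple-angle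
  formula cleared of denominators: at a root, the tripled angle has tangent
  \<open>- (a * b * c)\<close>.\<close>

lemma tan_triple_cubic:
  assumes "tan_triple s a b c" "s \<noteq> 0"
  shows "x ^ 3 + 3 * (a * b * c) * x\<^sup>2 - 3 * x - a * b * c = (x - a) * (x - b) * (x - c)"
  using tan_triple_symmetric_functions[OF assms] by algebra

text \<open>\<open>3 * a\<^sup>2 - 1\<close> is the coefficient of \<open>k\<close>; where it
  vanishes the cubic reduces to \<open>- 8 * a / 3\<close>, forcing \<open>a = 0\<close>.\<close>

lemma cubic_root_square_ne:
  fixes a k :: real
  assumes "a ^ 3 + 3 * k * a\<^sup>2 - 3 * a - k = 0"
  shows "3 * a\<^sup>2 \<noteq> 1"
proof
  assume sq: "3 * a\<^sup>2 = 1"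
  have "8 * a = 0" using assms sq by algebra
  with sq show False by simp
qed

lemma cubic_root_parameter_unique:
  fixes a k l :: real
  assumes "a ^ 3 + 3 * k * a\<^sup>2 - 3 * a - k = 0" "a ^ 3 + 3 * l * a\<^sup>2 - 3 * a - l = 0"
  shows "k = l"
proof -
  have "(k - l) * (3 * a\<^sup>2 - 1) = 0"
    using assms by algebra
  then show ?thesis using cubic_root_square_ne[OF assms(1)] by simp
qed

text \<open>A common member would be a root of both cubics, and a root determines the parameter of
  its cubic.\<close>

lemma tan_triple_disjoint:
  assumes "tan_triple s a b c" "tan_triple s' x y z" "s \<noteq> 0" "s' \<noteq> 0" "a * b * c \<noteq> x * y * z"
  shows "{a, b, c} \<inter> {x, y, z} = {}"
proof -
  have "a * b * c = x * y * z" if "r \<in> {a, b, c}" "r \<in> {x, y, z}" for r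
  proof (rule cubic_root_parameter_unique)
    show "r ^ 3 + 3 * (a * b * c) * r\<^sup>2 - 3 * r - a * b * c = 0"
      using that(1) unfolding tan_triple_cubic[OF assms(1,3)] by auto
    show "r ^ 3 + 3 * (x * y * z) * r\<^sup>2 - 3 * r - x * y * z = 0"
      using that(2) unfolding tan_triple_cubic[OF assms(2,4)] by auto
  qed
  with assms(5) show ?thesis by blast
qed

lemma cubic_root_tan_triple:
  fixes a k s :: real
  assumes "a ^ 3 + 3 * k * a\<^sup>2 - 3 * a - k = 0" "s\<^sup>2 = 3"
  obtains b c where "tan_triple s a b c" "a * b * c = k"
proof
  \<comment> \<open>Tangent addition formulas for the angle of \<open>a\<close> plus and minus the
    angle with tangent \<open>s\<close>.\<close>
  let ?b = "(a + s) / (1 - s * a)" and ?c = "(a - s) / (1 + s * a)"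
  have "(1 - s * a) * (1 + s * a) = 1 - 3 * a\<^sup>2"
    using assms(2) by (simp add: algebra_simps power2_eq_square flip: mult.assoc)
  then have nz: "1 - s * a \<noteq> 0" "1 + s * a \<noteq> 0"
    using cubic_root_square_ne[OF assms(1)] by auto
  have b: "?b * (1 - s * a) = a + s" and c: "?c * (1 + s * a) = a - s"
    using nz by auto
  have 1: "?b - a = s * (1 + a * ?b)" using b by algebra
  have 3: "a - ?c = s * (1 + ?c * a)" using c by algebra
  \<comment> \<open>The one equation not built into the choice of \<open>?b\<close> and
    \<open>?c\<close>; it closes the cycle because \<open>s\<^sup>2 = 3\<close>.\<close>
  have "(1 - s * a) * (1 + s * a) * (?c - ?b) = (1 - s * a) * (1 + s * a) * (s * (1 + ?b * ?c))"
    using b c assms(2) by algebra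
  then have 2: "?c - ?b = s * (1 + ?b * ?c)" using nz by simp
  show "tan_triple s a ?b ?c" using 1 2 3 by (simp add: tan_triple_def)
  have "(1 - s * a) * (1 + s * a) * (a * ?b * ?c) = (1 - s * a) * (1 + s * a) * k"
    using b c assms by algebra
  then show "a * ?b * ?c = k" using nz by simp
qed

text \<open>In angles, the left side is \<open>3 / 4\<close> over the squared product of the three
  cosines, and at 60 degree steps that product is, up to sign, a quarter of the cosine of the
  tripled angle.\<close>

lemma tan_triple_chord:
  assumes "tan_triple s a b c" "s\<^sup>2 = 3"
  shows "(a - b)\<^sup>2 * (1 + c\<^sup>2) = 12 * (1 + (a * b * c)\<^sup>2)"
proof -
  have s: "s \<noteq> 0" using assms by auto
  define k where "k = a * b * c"
  have e: "a * b + b * c + c * a = -3" "a + b + c = -3 * k"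
    using tan_triple_symmetric_functions[OF assms(1) s] by (auto simp: k_def)
  have cub: "c ^ 3 + 3 * k * c\<^sup>2 - 3 * c - k = 0"
    using tan_triple_cubic[OF assms(1) s, of c] by (simp add: k_def)
  have nz: "3 * c\<^sup>2 - 1 \<noteq> 0" using cubic_root_square_ne[OF cub] by simp
  have 1: "(3 * c\<^sup>2 - 1) * (1 + a * b) = 2 * (1 + c\<^sup>2)"
    using e cub by algebra
  \<comment> \<open>This is sec^2 = 1 + tan^2 at the tripled angle, whose tangent is
    \<open>- k\<close>.\<close>
  have 2: "(3 * c\<^sup>2 - 1)\<^sup>2 * (1 + k\<^sup>2) = (1 + c\<^sup>2) ^ 3"
    using cub by algebra
  have 3: "(a - b)\<^sup>2 = 3 * (1 + a * b)\<^sup>2"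
    using assms unfolding tan_triple_def by algebra
  have "(3 * c\<^sup>2 - 1)\<^sup>2 * ((a - b)\<^sup>2 * (1 + c\<^sup>2)) = (3 * c\<^sup>2 - 1)\<^sup>2 * (12 * (1 + k\<^sup>2))"
    using 1 2 3 by algebra
  then show ?thesis using nz by (simp add: k_def)
qed

text \<open>The opposite steps cancel in the sums of corresponding angles. Equality of the tangents
  of these sums is cross-multiplied to cover a sum of 90 degrees.\<close>

lemma tan_triple_opposite_cross:
  assumes "tan_triple s a b c" "tan_triple (-s) x y z"
  shows "(a + x) * (1 - b * y) = (b + y) * (1 - a * x)"
    "(a + x) * (1 - c * z) = (c + z) * (1 - a * x)"
  using assms unfolding tan_triple_def by algebra+

section \<open>Orthonormal frames\<close>

definition perp :: "real^2 \<Rightarrow> real^2" where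
  "perp x = vector [- (x$2), x$1]"

lemma perp_nth [simp]: "perp x $ 1 = - (x$2)" "perp x $ 2 = x$1"
  by (simp_all add: perp_def)

lemma vec2_eq_iff: "(x::real^2) = y \<longleftrightarrow> x$1 = y$1 \<and> x$2 = y$2"
  by (simp add: vec_eq_iff forall_2)

lemma dist_vec2_squared: "(dist x y)\<^sup>2 = (x$1 - y$1)\<^sup>2 + (x$2 - y$2)\<^sup>2" for x y :: "real^2"
  by (simp add: dist_norm power2_norm_eq_inner inner_vec_def sum_2 flip: power2_eq_square)

lemma dist_eq_iff_squared: "dist a b = dist c d \<longleftrightarrow> (dist a b)\<^sup>2 = (dist c d)\<^sup>2"
  by simp

locale orthonormal_frame =
  fixes M d :: "real^2"
  assumes unit: "norm d = 1"
begin

definition pt :: "real \<Rightarrow> real \<Rightarrow> real^2" where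
  "pt u v = M + u *\<^sub>R d + v *\<^sub>R perp d"

lemma unit_squares: "(d$1)\<^sup>2 + (d$2)\<^sup>2 = 1"
proof -
  have "(norm d)\<^sup>2 = (d$1)\<^sup>2 + (d$2)\<^sup>2"
    using dist_vec2_squared[of d 0] by simp
  with unit show ?thesis by simp
qed

lemma pt_nth: "pt u v $ 1 = M$1 + u * d$1 - v * d$2" "pt u v $ 2 = M$2 + u * d$2 + v * d$1"
  by (simp_all add: pt_def)

lemma dist_pt_squared: "(dist (pt u v) (pt u' v'))\<^sup>2 = (u - u')\<^sup>2 + (v - v')\<^sup>2"
  unfolding dist_vec2_squared pt_nth using unit_squares by algebra

lemma pt_eq_iff: "pt u v = pt u' v' \<longleftrightarrow> u = u' \<and> v = v'"
proof
  assume "pt u v = pt u' v'"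
  then have "(u - u')\<^sup>2 + (v - v')\<^sup>2 = 0"
    using dist_pt_squared[of u v u' v'] by simp
  then show "u = u' \<and> v = v'" by (simp add: sum_power2_eq_zero_iff)
qed simp

lemma pt_cases:
  obtains u v where "X = pt u v"
proof
  show "X = pt ((X - M) \<bullet> d) ((X - M) \<bullet> perp d)"
    unfolding vec2_eq_iff pt_nth
    using unit_squares
    by (simp add: inner_vec_def sum_2) algebra
qed

lemma collinear_pt_axis: "collinear {pt a 0, pt b 0, pt c 0}"
  unfolding collinear_def
proof (intro exI[of _ d] ballI)
  show "\<exists>k. x - y = k *\<^sub>R d" if "x \<in> {pt a 0, pt b 0, pt c 0}" "y \<in> {pt a 0, pt b 0, pt c 0}" for x y
  proof -
    obtain i j where "x = pt i 0" "y = pt j 0" using \<open>x \<in> _\<close> \<open>y \<in> _\<close> by blast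
    then have "x - y = (i - j) *\<^sub>R d" by (simp add: pt_def algebra_simps)
    then show ?thesis ..
  qed
qed

lemma conic_in_frame:
  assumes "conic K"
  obtains a b c x y z where "(a, b, c) \<noteq> (0, 0, 0)"
    "\<And>u v. pt u v \<in> K \<longleftrightarrow> a * u\<^sup>2 + b * u * v + c * v\<^sup>2 + x * u + y * v + z = 0"
proof -
  obtain a b c x y z where nz: "(a, b, c) \<noteq> (0, 0, 0)"
    and K: "K = {X. a * (X$1)\<^sup>2 + b * (X$1) * (X$2) + c * (X$2)\<^sup>2 + x * (X$1) + y * (X$2) + z = 0}"
    using assms unfolding conic_def by blast
  define m n k l where "m = d$1" "n = d$2" "k = M$1" "l = M$2"
  have mn: "m\<^sup>2 + n\<^sup>2 = 1" using unit_squares by (simp add: m_n_k_l_def)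
  let ?a = "a * m\<^sup>2 + b * m * n + c * n\<^sup>2"
  let ?b = "b * (m\<^sup>2 - n\<^sup>2) + 2 * (c - a) * m * n"
  let ?c = "a * n\<^sup>2 - b * m * n + c * m\<^sup>2"
  let ?x = "2 * a * k * m + b * (k * n + l * m) + 2 * c * l * n + x * m + y * n"
  let ?y = "- 2 * a * k * n + b * (k * m - l * n) + 2 * c * l * m - x * n + y * m"
  let ?z = "a * k\<^sup>2 + b * k * l + c * l\<^sup>2 + x * k + y * l + z"
  show thesis
  proof
    \<comment> \<open>The inverse rotation recovers the old quadratic part, so the new one cannot
      vanish.\<close>
    have "a = ?a * m\<^sup>2 - ?b * m * n + ?c * n\<^sup>2" "c = ?a * n\<^sup>2 + ?b * m * n + ?c * m\<^sup>2"
      "b = 2 * (?a - ?c) * m * n + ?b * (m\<^sup>2 - n\<^sup>2)"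
      using mn by algebra+
    with nz show "(?a, ?b, ?c) \<noteq> (0, 0, 0)" by force
    show "pt u v \<in> K \<longleftrightarrow> ?a * u\<^sup>2 + ?b * u * v + ?c * v\<^sup>2 + ?x * u + ?y * v + ?z = 0" for u v
      unfolding K mem_Collect_eq pt_nth m_n_k_l_def[symmetric]
      by (rule arg_cong[where f = "\<lambda>r. r = 0"]) algebra
  qed
qed

end

section \<open>A parametrised rectangular hyperbola\<close>

locale rectangular_hyperbola = orthonormal_frame +
  fixes f g :: real
  assumes f_nz: "f \<noteq> 0" and g_nz: "g \<noteq> 0"
begin

text \<open>At parameter 0 the convention \<open>f / 0 = 0\<close> gives the centre
  \<open>M\<close>, which is off the hyperbola; the curve is the image of the nonzero parameters
  only.\<close>

definition hpt :: "real \<Rightarrow> real^2" where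
  "hpt a = pt (g * a) (f / a)"

lemma hpt_eq_iff: "hpt a = hpt b \<longleftrightarrow> a = b"
  by (auto simp: hpt_def pt_eq_iff g_nz)

lemma dist_hpt_squared:
  assumes "a \<noteq> 0" "b \<noteq> 0"
  shows "(dist (hpt a) (hpt b))\<^sup>2 = (a - b)\<^sup>2 * (g\<^sup>2 + f\<^sup>2 / (a * b)\<^sup>2)"
proof -
  have "f / a - f / b = - (f / (a * b)) * (a - b)"
    using assms by (simp add: field_simps)
  then show ?thesis
    unfolding hpt_def dist_pt_squared
    by (simp add: power_mult_distrib power_divide distrib_left flip: right_diff_distrib)
qed

text \<open>Along the hyperbola the equation of \<open>K\<close> becomes a polynomial of degree at
  most 4 with five roots. It vanishes identically, which leaves
  \<open>b * (u * v - f * g) = 0\<close>.\<close>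

lemma conic_eq_hyperbola:
  assumes "conic K" and S: "hpt ` S \<subseteq> K" "0 \<notin> S" "card S = 5"
  shows "K = hpt ` (- {0})"
proof -
  obtain a b c x y z where nz: "(a, b, c) \<noteq> (0, 0, 0)"
    and K: "\<And>u v. pt u v \<in> K \<longleftrightarrow> a * u\<^sup>2 + b * u * v + c * v\<^sup>2 + x * u + y * v + z = 0"
    using conic_in_frame[OF \<open>conic K\<close>] by metis
  \<comment> \<open>\<open>t\<^sup>2\<close> times the equation of the conic at
    \<open>hpt t\<close>, coefficients in ascending order.\<close>
  define p where "p = [: c * f\<^sup>2, y * f, b * f * g + z, x * g, a * g\<^sup>2 :]"
  have root: "poly p t = 0 \<longleftrightarrow> hpt t \<in> K" if "t \<noteq> 0" for t
  proof -
    have "poly p t = t\<^sup>2 * (a * (g * t)\<^sup>2 + b * (g * t) * (f / t) + c * (f / t)\<^sup>2 + x * (g * t) + y * (f / t) + z)"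
      using that by (simp add: p_def field_simps power2_eq_square)
    then show ?thesis using that by (simp add: hpt_def K)
  qed
  have "p = 0"
  proof (rule ccontr)
    assume "p \<noteq> 0"
    have "S \<subseteq> {t. poly p t = 0}"
      using root S by (auto simp: image_subset_iff) metis
    then have "5 \<le> card {t. poly p t = 0}"
      using S card_mono poly_roots_finite[OF \<open>p \<noteq> 0\<close>] by metis
    also have "\<dots> \<le> degree p"
      using \<open>p \<noteq> 0\<close> by (rule card_poly_roots_bound)
    also have "\<dots> \<le> 4"
      by (simp add: p_def)
    finally show False by simp
  qed
  then have z: "a = 0" "c = 0" "x = 0" "y = 0" "z = - b * f * g"
    using f_nz g_nz by (auto simp: p_def)
  with nz have b: "b \<noteq> 0" by simp
  have K': "pt u v \<in> K \<longleftrightarrow> u * v = f * g" for u v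
  proof -
    have "pt u v \<in> K \<longleftrightarrow> b * (u * v - f * g) = 0"
      by (simp add: K z algebra_simps)
    with b show ?thesis by simp
  qed
  show ?thesis
  proof (intro equalityI subsetI)
    fix X assume "X \<in> K"
    obtain u v where X: "X = pt u v" by (rule pt_cases)
    with \<open>X \<in> K\<close> have uv: "u * v = f * g" by (simp add: K')
    then have "u \<noteq> 0" using f_nz g_nz by auto
    then have "X = hpt (u / g)" "u / g \<noteq> 0"
      using uv g_nz by (auto simp: X hpt_def pt_eq_iff field_simps)
    then show "X \<in> hpt ` (- {0})" by blast
  next
    fix X assume "X \<in> hpt ` (- {0})"
    then obtain t where "t \<noteq> 0" "X = hpt t" by blast
    then show "X \<in> K" by (simp add: hpt_def K')
  qed
qed

section \<open>Circles and equilateral triangles on the hyperbola\<close>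

text \<open>Since \<open>f\<^sup>2 = g\<^sup>2 * k\<^sup>2\<close>, comparing squared distances
  gives a quartic in \<open>a\<close>. The circle passes through \<open>hpt k\<close>, which splits
  off the factor \<open>a - k\<close>; the cofactor is the cubic of triples with product
  \<open>k\<close>.\<close>

lemma sphere_hpt_iff:
  assumes "a \<noteq> 0" and k: "k = f / g \<or> k = - (f / g)"
  shows "hpt a \<in> sphere (hpt (- k)) (dist (hpt k) (hpt (- k))) \<longleftrightarrow>
    a = k \<or> a ^ 3 + 3 * k * a\<^sup>2 - 3 * a - k = 0"
proof -
  have f2: "f\<^sup>2 = g\<^sup>2 * k\<^sup>2" and "k \<noteq> 0"
    using k f_nz g_nz by (auto simp: power_divide)
  have "(dist (hpt (- k)) (hpt a))\<^sup>2 = (a + k)\<^sup>2 * (g\<^sup>2 + g\<^sup>2 / a\<^sup>2)"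
    using dist_hpt_squared[of a "- k"] assms \<open>k \<noteq> 0\<close>
    by (simp add: f2 power_mult_distrib dist_commute)
  also have "a\<^sup>2 * \<dots> = g\<^sup>2 * ((a + k)\<^sup>2 * (a\<^sup>2 + 1))"
    using \<open>a \<noteq> 0\<close> by (simp add: field_simps)
  finally have 1: "a\<^sup>2 * (dist (hpt (- k)) (hpt a))\<^sup>2 = g\<^sup>2 * ((a + k)\<^sup>2 * (a\<^sup>2 + 1))" .
  have 2: "(dist (hpt k) (hpt (- k)))\<^sup>2 = g\<^sup>2 * (4 * (k\<^sup>2 + 1))"
    using dist_hpt_squared[of k "- k"] \<open>k \<noteq> 0\<close>
    by (simp add: f2 power_mult_distrib) (simp add: field_simps power2_eq_square power4_eq_xxxx)
  have "hpt a \<in> sphere (hpt (- k)) (dist (hpt k) (hpt (- k))) \<longleftrightarrow>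
      a\<^sup>2 * (dist (hpt (- k)) (hpt a))\<^sup>2 = a\<^sup>2 * (dist (hpt k) (hpt (- k)))\<^sup>2"
    using \<open>a \<noteq> 0\<close> by simp
  also have "\<dots> \<longleftrightarrow> g\<^sup>2 * ((a + k)\<^sup>2 * (a\<^sup>2 + 1)) = g\<^sup>2 * (4 * a\<^sup>2 * (k\<^sup>2 + 1))"
    unfolding 1 2 by (simp add: algebra_simps)
  also have "\<dots> \<longleftrightarrow> (a + k)\<^sup>2 * (a\<^sup>2 + 1) - 4 * a\<^sup>2 * (k\<^sup>2 + 1) = 0"
    using g_nz by simp
  also have "(a + k)\<^sup>2 * (a\<^sup>2 + 1) - 4 * a\<^sup>2 * (k\<^sup>2 + 1) = (a - k) * (a ^ 3 + 3 * k * a\<^sup>2 - 3 * a - k)"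
    by algebra
  finally show ?thesis by simp
qed

text \<open>With \<open>f\<^sup>2 = g\<^sup>2 * (a * b * c)\<^sup>2\<close> each squared side is
  \<open>g\<^sup>2\<close> times the left side of \<open>tan_triple_chord\<close>, whose value
  depends only on the product of the triple.\<close>

lemma tan_triple_equilateral:
  assumes "tan_triple s a b c" "s\<^sup>2 = 3" and k: "a * b * c = f / g \<or> a * b * c = - (f / g)"
  shows "equilateral_triangle (hpt a) (hpt b) (hpt c)"
proof -
  have f2: "f\<^sup>2 = g\<^sup>2 * (a * b * c)\<^sup>2" and "a * b * c \<noteq> 0"
    using k f_nz g_nz by (auto simp: power_divide)
  then have nz: "a \<noteq> 0" "b \<noteq> 0" "c \<noteq> 0" by auto
  have side: "(dist (hpt x) (hpt y))\<^sup>2 = 12 * (g\<^sup>2 + f\<^sup>2)"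
    if "tan_triple s x y z" "x * y * z = a * b * c" for x y z
  proof -
    have "x * y * z \<noteq> 0" using that \<open>a * b * c \<noteq> 0\<close> by simp
    then have "x \<noteq> 0" "y \<noteq> 0" by auto
    then have "(dist (hpt x) (hpt y))\<^sup>2 = g\<^sup>2 * ((x - y)\<^sup>2 * (1 + z\<^sup>2))"
      unfolding f2 that(2)[symmetric] by (simp add: dist_hpt_squared f2 flip: that(2)) (simp add: field_simps)
    also have "\<dots> = 12 * (g\<^sup>2 + f\<^sup>2)"
      using tan_triple_chord[OF that(1) assms(2)] f2 that(2) by algebra
    finally show ?thesis .
  qed
  have sides: "(dist (hpt a) (hpt b))\<^sup>2 = 12 * (g\<^sup>2 + f\<^sup>2)" "(dist (hpt b) (hpt c))\<^sup>2 = 12 * (g\<^sup>2 + f\<^sup>2)"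
    "(dist (hpt c) (hpt a))\<^sup>2 = 12 * (g\<^sup>2 + f\<^sup>2)"
    using side[of a b c] side[of b c a] side[of c a b] assms(1) tan_triple_rotate[OF assms(1)]
      tan_triple_rotate[OF tan_triple_rotate[OF assms(1)]]
    by (simp_all add: ac_simps)
  then have eq: "dist (hpt a) (hpt b) = dist (hpt b) (hpt c)" "dist (hpt b) (hpt c) = dist (hpt c) (hpt a)"
    by (simp_all add: dist_eq_iff_squared)
  have pos: "dist (hpt a) (hpt b) > 0"
    using tan_triple_distinct(1)[OF assms(1)] assms(2) by (cases "s = 0") (auto simp: hpt_eq_iff)
  \<comment> \<open>Otherwise one side would be the sum of the other two, impossible for equal
    positive lengths.\<close>
  have "\<not> collinear {hpt a, hpt b, hpt c}"
    using eq pos by (auto simp: collinear_between_cases between dist_commute)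
  with eq show ?thesis by (simp add: equilateral_triangle_def)
qed

text \<open>One intersection point generates a triple containing all roots of the cubic, and
  counting turns inclusion into equality. Either sign of \<open>s\<close> may be prescribed, so the
  cyclic sense of the triple can be chosen.\<close>

lemma sphere_Int_hyperbola:
  assumes "K = hpt ` (- {0})" and k: "k = f / g \<or> k = - (f / g)" and s: "s\<^sup>2 = 3"
    and card: "card (sphere (hpt (- k)) (dist (hpt k) (hpt (- k))) \<inter> K - {hpt k}) = 3"
  obtains a b c where "tan_triple s a b c" "a * b * c = k"
    "{hpt a, hpt b, hpt c} = sphere (hpt (- k)) (dist (hpt k) (hpt (- k))) \<inter> K - {hpt k}"
proof -
  let ?S = "sphere (hpt (- k)) (dist (hpt k) (hpt (- k))) \<inter> K - {hpt k}"
  have root: "\<exists>a. X = hpt a \<and> a ^ 3 + 3 * k * a\<^sup>2 - 3 * a - k = 0" if "X \<in> ?S" for X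
    using that sphere_hpt_iff[OF _ k] assms(1) by auto
  have "?S \<noteq> {}" using card by (metis card.empty zero_neq_numeral)
  then obtain a where a: "a ^ 3 + 3 * k * a\<^sup>2 - 3 * a - k = 0"
    using root by blast
  then obtain b c where bc: "tan_triple s a b c" "a * b * c = k"
    using s by (rule cubic_root_tan_triple)
  have "s \<noteq> 0" using s by auto
  have "?S \<subseteq> {hpt a, hpt b, hpt c}"
    using root tan_triple_cubic[OF bc(1) \<open>s \<noteq> 0\<close>] bc(2) by fastforce
  moreover have "card {hpt a, hpt b, hpt c} = 3"
    using tan_triple_distinct[OF bc(1) \<open>s \<noteq> 0\<close>] by (simp add: hpt_eq_iff)
  ultimately have "{hpt a, hpt b, hpt c} = ?S"
    using card by (metis card_subset_eq finite.emptyI finite_insert)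
  with bc show thesis by (rule that)
qed

section \<open>Concurrent chords and the axis of perspectors\<close>

definition direction3 :: "real^2 \<Rightarrow> real^3" where
  "direction3 x = vector [x$1, x$2, 0]"

lemma homogeneous_hpt:
  "homogeneous (hpt a) = homogeneous M + (g * a) *\<^sub>R direction3 d + (f / a) *\<^sub>R direction3 (perp d)"
  by (simp add: homogeneous_def direction3_def hpt_def pt_nth vec_eq_iff forall_3)

text \<open>The point lying on all chords between parameters \<open>tan \<phi>\<close> and \<open>tan \<psi>\<close> with
  \<open>tan (\<phi> + \<psi>) = x / y\<close>, including the point at infinity \<open>y = 0\<close>.\<close>

definition axis_vec :: "real \<Rightarrow> real \<Rightarrow> real^3" where
  "axis_vec x y = y *\<^sub>R homogeneous M + x *\<^sub>R direction3 (g *\<^sub>R d - f *\<^sub>R perp d)"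

lemma axis_vec_eq_0_iff: "axis_vec x y = 0 \<longleftrightarrow> x = 0 \<and> y = 0"
proof
  assume 0: "axis_vec x y = 0"
  then have "axis_vec x y $ 3 = 0" by simp
  then have y: "y = 0" by (simp add: axis_vec_def homogeneous_def direction3_def)
  have "axis_vec x y $ 1 = 0" "axis_vec x y $ 2 = 0" using 0 by simp_all
  then have "x * (g * d$1 + f * d$2) = 0" "x * (g * d$2 - f * d$1) = 0"
    using y by (simp_all add: axis_vec_def homogeneous_def direction3_def)
  then have "x * g = 0" using unit_squares by algebra
  then show "x = 0 \<and> y = 0" using g_nz y by simp
qed (simp add: axis_vec_def)

lemma axis_vec_linear:
  "axis_vec (c * x) (c * y) = c *\<^sub>R axis_vec x y"
  "axis_vec x y = x *\<^sub>R axis_vec 1 0 + y *\<^sub>R axis_vec 0 1"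
  by (simp_all add: axis_vec_def algebra_simps)

lemma axis_vec_in_join_line:
  assumes "a \<noteq> b" "a \<noteq> 0" "b \<noteq> 0"
  shows "axis_vec (a + b) (1 - a * b) \<in> join_line (hpt a) (hpt b)"
proof -
  \<comment> \<open>The first two equations of \<open>xy\<close> determine these weights by Cramer's
    rule; the third then holds as well.\<close>
  define x y where "x = a * (1 + b\<^sup>2) / (a - b)" and "y = - b * (1 + a\<^sup>2) / (a - b)"
  have xy: "x + y = 1 - a * b" "x * a + y * b = a + b" "x / a + y / b = - (a + b)"
    using assms
    by (simp_all add: x_def y_def divide_simps) (simp_all add: algebra_simps power2_eq_square)
  have "direction3 (g *\<^sub>R d - f *\<^sub>R perp d) = g *\<^sub>R direction3 d - f *\<^sub>R direction3 (perp d)"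
    by (simp add: direction3_def vec_eq_iff forall_3)
  then have axis: "axis_vec u w = w *\<^sub>R homogeneous M + (g * u) *\<^sub>R direction3 d
      - (f * u) *\<^sub>R direction3 (perp d)" for u w
    unfolding axis_vec_def by (simp only: scaleR_right_diff_distrib scaleR_scaleR mult.commute add_diff_eq)
  have "axis_vec (a + b) (1 - a * b) = (x + y) *\<^sub>R homogeneous M
      + (g * (x * a + y * b)) *\<^sub>R direction3 d + (f * (x / a + y / b)) *\<^sub>R direction3 (perp d)"
    unfolding xy axis by (simp only: mult_minus_right scaleR_minus_left diff_conv_add_uminus)
  also have "\<dots> = x *\<^sub>R homogeneous (hpt a) + y *\<^sub>R homogeneous (hpt b)"
    by (simp add: homogeneous_hpt algebra_simps add_divide_distrib)
  also have "\<dots> \<in> join_line (hpt a) (hpt b)"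
    unfolding join_line_def by (intro span_add span_scale span_base) auto
  finally show ?thesis .
qed

text \<open>The tangent of an angle sum is never 0/0, so \<open>axis_vec\<close> at these arguments
  is a genuine projective point.\<close>

lemma chord_parameters_nonzero:
  fixes a b :: real
  shows "a + b \<noteq> 0 \<or> 1 - a * b \<noteq> 0"
proof (rule ccontr)
  assume "\<not> ?thesis"
  then have "a + b = 0" "a * b = 1" by auto
  then have "1 + a * a = 0" by algebra
  then show False by (smt (verit) zero_le_square)
qed

lemma cross_zero_proportional:
  fixes x y z w :: real
  assumes "x * w = z * y" "z \<noteq> 0 \<or> w \<noteq> 0"
  obtains c where "x = c * z" "y = c * w"
proof (cases "z = 0")
  case True
  with assms show thesis by (intro that[of "y / w"]) auto
next
  case False
  with assms show thesis by (intro that[of "x / z"]) (auto simp: field_simps)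
qed

text \<open>By the cross relations the axis vectors of the three chords are proportional.
  Disjointness of the triples makes each chord a proper line.\<close>

lemma tan_triple_perspector:
  assumes T: "tan_triple s a b c" "tan_triple (- s) x y z"
    and disj: "{a, b, c} \<inter> {x, y, z} = {}" and nz: "0 \<notin> {a, b, c} \<union> {x, y, z}"
  shows "perspector (hpt a) (hpt b) (hpt c) (hpt x) (hpt y) (hpt z) (span {axis_vec (a + x) (1 - a * x)})"
proof -
  let ?v = "axis_vec (a + x) (1 - a * x)"
  have on_chord: "span {?v} \<subseteq> join_line (hpt p) (hpt q)"
    if cross: "(a + x) * (1 - p * q) = (p + q) * (1 - a * x)" and pq: "p \<in> {a, b, c}" "q \<in> {x, y, z}" for p q
  proof -
    obtain r where "a + x = r * (p + q)" "1 - a * x = r * (1 - p * q)"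
      using cross_zero_proportional[OF cross chord_parameters_nonzero] by blast
    then have "?v = r *\<^sub>R axis_vec (p + q) (1 - p * q)"
      by (simp add: axis_vec_linear(1))
    moreover have "axis_vec (p + q) (1 - p * q) \<in> join_line (hpt p) (hpt q)"
      using pq disj nz by (intro axis_vec_in_join_line) auto
    moreover have "subspace (join_line (hpt p) (hpt q))"
      by (simp add: join_line_def)
    ultimately show ?thesis
      by (simp add: span_minimal subspace_scale)
  qed
  have "?v \<noteq> 0"
    using chord_parameters_nonzero[of a x] by (auto simp: axis_vec_eq_0_iff)
  then have "proj_point (span {?v})"
    by (simp add: proj_point_def dim_insert)
  then show ?thesis
    unfolding perspector_def hpt_eq_iff
    by (intro conjI on_chord) (use disj tan_triple_opposite_cross[OF T] in auto)
qed

text \<open>The line joins the centre, \<open>axis_vec 0 1\<close>, to the point at infinity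
  \<open>axis_vec 1 0\<close>.\<close>

lemma proj_line_axis: "proj_line (span {axis_vec 1 0, axis_vec 0 1})"
proof -
  have "axis_vec 1 0 \<notin> span {axis_vec 0 1}"
  proof
    assume "axis_vec 1 0 \<in> span {axis_vec 0 1}"
    then obtain k where "axis_vec 1 0 = k *\<^sub>R axis_vec 0 1" by (auto simp: span_singleton)
    then have "axis_vec 1 (- k) = 0"
      using axis_vec_linear(2)[of 1 "- k"] by simp
    then show False by (simp add: axis_vec_eq_0_iff)
  qed
  then show ?thesis
    by (simp add: proj_line_def dim_insert axis_vec_eq_0_iff)
qed

lemma span_axis_vec_subset: "span {axis_vec x y} \<subseteq> span {axis_vec 1 0, axis_vec 0 1}"
proof -
  have "axis_vec x y \<in> span {axis_vec 1 0, axis_vec 0 1}"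
    unfolding axis_vec_linear(2)[of x y] by (intro span_add span_scale span_base) auto
  then show ?thesis by (simp add: span_minimal)
qed

text \<open>Cyclic shifts of the second triple are again triples with the same step.\<close>

lemma triply_perspective:
  assumes T: "tan_triple s a b c" "tan_triple (- s) x y z"
    and disj: "{a, b, c} \<inter> {x, y, z} = {}" and nz: "0 \<notin> {a, b, c} \<union> {x, y, z}"
  obtains X\<^sub>1 X\<^sub>2 X\<^sub>3 where
    "perspector (hpt a) (hpt b) (hpt c) (hpt x) (hpt y) (hpt z) X\<^sub>1"
    "perspector (hpt a) (hpt b) (hpt c) (hpt y) (hpt z) (hpt x) X\<^sub>2"
    "perspector (hpt a) (hpt b) (hpt c) (hpt z) (hpt x) (hpt y) X\<^sub>3"
    "X\<^sub>1 \<union> X\<^sub>2 \<union> X\<^sub>3 \<subseteq> span {axis_vec 1 0, axis_vec 0 1}"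
proof
  note T2 = tan_triple_rotate[OF T(2)]
  show "perspector (hpt a) (hpt b) (hpt c) (hpt x) (hpt y) (hpt z) (span {axis_vec (a + x) (1 - a * x)})"
    using assms by (rule tan_triple_perspector)
  show "perspector (hpt a) (hpt b) (hpt c) (hpt y) (hpt z) (hpt x) (span {axis_vec (a + y) (1 - a * y)})"
    using disj nz by (intro tan_triple_perspector[OF T(1) T2]) auto
  show "perspector (hpt a) (hpt b) (hpt c) (hpt z) (hpt x) (hpt y) (span {axis_vec (a + z) (1 - a * z)})"
    using disj nz by (intro tan_triple_perspector[OF T(1) tan_triple_rotate[OF T2]]) auto
qed (intro Un_least span_axis_vec_subset)

end

section \<open>Apices and Fermat directions\<close>

text \<open>Twice the signed area; for fixed \<open>B\<close> and \<open>C\<close>, its sign tells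
  the side of the line \<open>BC\<close>.\<close>

definition orient :: "real^2 \<Rightarrow> real^2 \<Rightarrow> real^2 \<Rightarrow> real" where
  "orient A B C = (B$1 - A$1) * (C$2 - A$2) - (B$2 - A$2) * (C$1 - A$1)"

text \<open>Apex of the isosceles triangle on \<open>BC\<close> with signed height \<open>h\<close>
  times the base; \<open>h = \<plusminus> sqrt 3 / 2\<close> gives the two equilateral ones.\<close>

definition erected :: "real \<Rightarrow> real^2 \<Rightarrow> real^2 \<Rightarrow> real^2" where
  "erected h B C = (1/2) *\<^sub>R (B + C) + h *\<^sub>R perp (C - B)"

lemma orient_rotate: "orient B C A = orient A B C"
  by (simp add: orient_def algebra_simps)

lemma sum_squares_eq_dist: "(C$1 - B$1)\<^sup>2 + (C$2 - B$2)\<^sup>2 = (dist B C)\<^sup>2" for B C :: "real^2"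
  unfolding dist_vec2_squared by algebra

lemma in_affine_hull_iff_orient:
  assumes "B \<noteq> C"
  shows "X \<in> affine hull {B, C} \<longleftrightarrow> orient B C X = 0"
proof
  assume "X \<in> affine hull {B, C}"
  then obtain u v where "u + v = 1" and X: "X = u *\<^sub>R B + v *\<^sub>R C"
    by (auto simp: affine_hull_2)
  then have u: "u = 1 - v" by simp
  show "orient B C X = 0"
    unfolding X u by (simp add: orient_def algebra_simps)
next
  assume o: "orient B C X = 0"
  \<comment> \<open>\<open>t\<close> is the parameter of the orthogonal projection of
    \<open>X\<close> to the line \<open>BC\<close>.\<close>
  define n t where "n = (C$1 - B$1)\<^sup>2 + (C$2 - B$2)\<^sup>2"
    and "t = ((X$1 - B$1) * (C$1 - B$1) + (X$2 - B$2) * (C$2 - B$2)) / n"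
  have "n \<noteq> 0" using assms by (simp add: n_def sum_squares_eq_dist)
  then have t: "t * n = (X$1 - B$1) * (C$1 - B$1) + (X$2 - B$2) * (C$2 - B$2)"
    by (simp add: t_def)
  have "n * X$1 = n * ((1 - t) * B$1 + t * C$1)" "n * X$2 = n * ((1 - t) * B$2 + t * C$2)"
    using t o unfolding n_def orient_def by algebra+
  then have "X = (1 - t) *\<^sub>R B + t *\<^sub>R C"
    using \<open>n \<noteq> 0\<close> by (simp add: vec2_eq_iff)
  moreover have "(1 - t) + t = 1" by simp
  ultimately show "X \<in> affine hull {B, C}"
    unfolding affine_hull_2 by blast
qed

lemma orient_convex_combination:
  "orient B C ((1 - t) *\<^sub>R X + t *\<^sub>R Y) = (1 - t) * orient B C X + t * orient B C Y"
  by (simp add: orient_def algebra_simps)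

lemma opposite_sides_orient:
  assumes "B \<noteq> C" "opposite_sides B C X Y"
  shows "orient B C X * orient B C Y < 0"
proof -
  have nz: "orient B C X \<noteq> 0" "orient B C Y \<noteq> 0"
    using assms in_affine_hull_iff_orient by (auto simp: opposite_sides_def)
  obtain t where t: "0 \<le> t" "t \<le> 1" "(1 - t) * orient B C X + t * orient B C Y = 0"
    using assms in_affine_hull_iff_orient[OF \<open>B \<noteq> C\<close>]
    by (auto simp: opposite_sides_def closed_segment_def orient_convex_combination)
  have "t \<noteq> 0" using t nz by auto
  have "(1 - t) * (orient B C X)\<^sup>2 + t * (orient B C X * orient B C Y) = 0"
    using t(3) by algebra
  moreover have "(1 - t) * (orient B C X)\<^sup>2 \<ge> 0" using t by simp
  ultimately have "t * (orient B C X * orient B C Y) \<le> 0" by simp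
  with \<open>t \<noteq> 0\<close> t(1) have "orient B C X * orient B C Y \<le> 0"
    by (simp add: mult_le_0_iff)
  with nz show ?thesis by (simp add: order_less_le)
qed

lemma same_side_orient:
  assumes "B \<noteq> C" "same_side B C X Y"
  shows "orient B C X * orient B C Y > 0"
proof (rule ccontr)
  assume "\<not> ?thesis"
  then have le: "orient B C X * orient B C Y \<le> 0" by simp
  have off: "orient B C ((1 - t) *\<^sub>R X + t *\<^sub>R Y) \<noteq> 0" if "0 \<le> t" "t \<le> 1" for t
    using assms that in_affine_hull_iff_orient[OF \<open>B \<noteq> C\<close>]
    by (auto simp: same_side_def closed_segment_def)
  have nz: "orient B C X \<noteq> 0" "orient B C Y \<noteq> 0"
    using off[of 0] off[of 1] by simp_all
  \<comment> \<open>Zero of the affine function \<open>orient B C\<close> along the segment, that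
    is, the crossing point.\<close>
  define t where "t = orient B C X / (orient B C X - orient B C Y)"
  have sgn: "orient B C X > 0 \<and> orient B C Y < 0 \<or> orient B C X < 0 \<and> orient B C Y > 0"
    using le nz by (auto simp: mult_le_0_iff)
  then have "0 \<le> t" "t \<le> 1"
    by (auto simp: t_def zero_le_divide_iff divide_le_eq_1)
  moreover have "t * (orient B C X - orient B C Y) = orient B C X"
    using sgn by (auto simp: t_def)
  then have "(1 - t) * orient B C X + t * orient B C Y = 0" by (simp add: algebra_simps)
  ultimately show False using off[of t] by (simp add: orient_convex_combination)
qed

lemma orient_erected: "orient B C (erected h B C) = h * (dist B C)\<^sup>2"
  unfolding dist_vec2_squared by (simp add: orient_def erected_def power2_eq_square field_simps)

lemma equilateral_apex:
  assumes "equilateral_triangle X B C" "h\<^sup>2 = 3 / 4"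
  shows "X = erected h B C \<or> X = erected (- h) B C"
proof -
  have "B \<noteq> C" using assms by (auto simp: equilateral_triangle_def)
  have d: "(dist X B)\<^sup>2 = (dist B C)\<^sup>2" "(dist X B)\<^sup>2 = (dist C X)\<^sup>2"
    using assms by (auto simp: equilateral_triangle_def)
  define n where "n = (dist B C)\<^sup>2"
  have n: "n \<noteq> 0" "n = (B$1 - C$1)\<^sup>2 + (B$2 - C$2)\<^sup>2"
    using \<open>B \<noteq> C\<close> by (auto simp: n_def dist_vec2_squared[symmetric])
  have h4: "4 * h\<^sup>2 = 3" using assms by simp
  \<comment> \<open>Twice the area of an equilateral triangle is \<open>sqrt 3 / 2\<close> times its
    squared side.\<close>
  have "4 * ((orient B C X - h * n) * (orient B C X + h * n)) = 0"
    using d h4 unfolding n(2) orient_def dist_vec2_squared by algebra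
  then consider "orient B C X = h * n" | "orient B C X = (- h) * n"
    by (auto simp: add_eq_0_iff)
  moreover have "X = erected k B C" if "orient B C X = k * n" for k
  proof -
    \<comment> \<open>Equidistance from \<open>B\<close> and \<open>C\<close> fixes the component
      along \<open>BC\<close>, and \<open>orient\<close> the perpendicular one.\<close>
    have "2 * n * X$1 = n * (B$1 + C$1 - 2 * k * (C$2 - B$2))"
      "2 * n * X$2 = n * (B$2 + C$2 + 2 * k * (C$1 - B$1))"
      using that d unfolding n(2) orient_def dist_vec2_squared by algebra+
    then have "2 * X$1 = B$1 + C$1 - 2 * k * (C$2 - B$2)" "2 * X$2 = B$2 + C$2 + 2 * k * (C$1 - B$1)"
      using n(1) by (auto simp: mult.assoc mult.left_commute[of 2 n])
    then show ?thesis by (simp add: vec2_eq_iff erected_def algebra_simps)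
  qed
  ultimately show ?thesis by blast
qed

text \<open>When \<open>h\<close> has the sign of the orientation, \<open>erected h B C\<close> lies
  on the side of \<open>A\<close>, so the outward apex takes \<open>- h\<close>.\<close>

lemma outer_apex_eq_erected:
  assumes "outer_apex A B C X" "h\<^sup>2 = 3 / 4" "h * orient A B C > 0"
  shows "X = erected (- h) B C"
proof -
  have eq: "equilateral_triangle X B C" and opp: "opposite_sides B C A X"
    using assms by (auto simp: outer_apex_def)
  have "B \<noteq> C" using eq by (auto simp: equilateral_triangle_def)
  have "orient A B C * orient B C X < 0"
    using opposite_sides_orient[OF \<open>B \<noteq> C\<close> opp] by (simp add: orient_rotate)
  moreover have "orient A B C * (h * (dist B C)\<^sup>2) > 0"
    using mult_pos_pos[OF assms(3), of "(dist B C)\<^sup>2"] \<open>B \<noteq> C\<close> by (simp add: ac_simps)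
  ultimately have "X \<noteq> erected h B C"
    using orient_erected[of B C h] by auto
  with equilateral_apex[OF eq assms(2)] show ?thesis by blast
qed

lemma inner_apex_eq_erected:
  assumes "inner_apex A B C X" "h\<^sup>2 = 3 / 4" "h * orient A B C > 0"
  shows "X = erected h B C"
proof -
  have eq: "equilateral_triangle X B C" and same: "same_side B C A X"
    using assms by (auto simp: inner_apex_def)
  have "B \<noteq> C" using eq by (auto simp: equilateral_triangle_def)
  have "orient A B C * orient B C X > 0"
    using same_side_orient[OF \<open>B \<noteq> C\<close> same] by (simp add: orient_rotate)
  moreover have "orient A B C * (h * (dist B C)\<^sup>2) > 0"
    using mult_pos_pos[OF assms(3), of "(dist B C)\<^sup>2"] \<open>B \<noteq> C\<close> by (simp add: ac_simps)
  ultimately have "X \<noteq> erected (- h) B C"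
    using orient_erected[of B C "- h"] by auto
  with equilateral_apex[OF eq assms(2)] show ?thesis by blast
qed

lemma affine_hull_pair_offset:
  fixes A F X :: "real^2"
  assumes "F \<in> affine hull {A, X}"
  obtains t where "F + t *\<^sub>R (X - A) = A"
proof -
  obtain u v where "u + v = 1" "F = u *\<^sub>R A + v *\<^sub>R X"
    using assms by (auto simp: affine_hull_2)
  moreover from this have "u = 1 - v" by simp
  ultimately have "F + (- v) *\<^sub>R (X - A) = A" by (simp add: algebra_simps)
  then show thesis by (rule that)
qed

text \<open>The right side is \<open>v\<close> rotated by 120 degrees: successive vertex-to-apex
  vectors are equal in length and turn by a third of a circle.\<close>

lemma erected_direction_rotate:
  assumes "h\<^sup>2 = 3 / 4" and v: "erected h B C - A = v"
  shows "erected h C A - B = (- 1/2) *\<^sub>R v - h *\<^sub>R perp v"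
proof -
  have hh: "h * (h * x) = 3 / 4 * x" for x
    using assms(1) by (simp add: power2_eq_square flip: mult.assoc)
  show ?thesis
    unfolding v[symmetric] vec2_eq_iff by (simp add: erected_def algebra_simps hh)
qed

text \<open>The apex is equidistant from \<open>B\<close> and \<open>C\<close>, so coinciding with
  \<open>A\<close> would make the triangle isosceles.\<close>

lemma erected_ne_opposite_vertex:
  assumes "scalene_triangle A B C"
  shows "erected h B C - A \<noteq> 0"
proof
  assume "erected h B C - A = 0"
  then have "A = erected h B C" by simp
  then have "2 * A$1 = B$1 + C$1 - 2 * (h * (C$2 - B$2))" "2 * A$2 = B$2 + C$2 + 2 * (h * (C$1 - B$1))"
    by (simp_all add: erected_def algebra_simps)
  then have "4 * (dist C A)\<^sup>2 = 4 * (dist A B)\<^sup>2"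
    unfolding dist_vec2_squared by algebra
  with assms show False by (simp add: scalene_triangle_def)
qed

section \<open>The Kiepert hyperbola\<close>

text \<open>\<open>d\<close> bisects the angle of \<open>v\<close> and \<open>w\<close>. Reflection
  in \<open>d\<close> reverses the sense of rotations, so one frame serves the outward and inward
  directions at all three vertices.\<close>

lemma exists_bisecting_frame:
  fixes v w :: "real^2"
  assumes "v \<noteq> 0" "w \<noteq> 0"
  obtains d p q r where "norm d = 1" "v = p *\<^sub>R d + q *\<^sub>R perp d" "w = r *\<^sub>R (p *\<^sub>R d - q *\<^sub>R perp d)"
proof (cases "norm w *\<^sub>R v + norm v *\<^sub>R w = 0")
  \<comment> \<open>For opposite directions the bisecting sum vanishes; \<open>d\<close> is taken
    along \<open>v\<close>, with \<open>q = 0\<close> and \<open>r\<close> negative.\<close>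
  case True
  let ?d = "(1 / norm v) *\<^sub>R v"
  have "norm w *\<^sub>R v = - norm v *\<^sub>R w"
    using True by (simp add: add_eq_0_iff)
  then have "(- 1 / norm v) *\<^sub>R (norm w *\<^sub>R v) = w"
    using assms by simp
  then have "w = (- norm w / norm v) *\<^sub>R v" by simp
  then show thesis
    using assms by (intro that[of ?d "norm v" 0 "- norm w / norm v"]) auto
next
  case False
  define e where "e = norm w *\<^sub>R v + norm v *\<^sub>R w"
  define d where "d = (1 / norm e) *\<^sub>R e"
  have "norm d = 1" using False by (simp add: d_def e_def)
  then interpret orthonormal_frame 0 d by unfold_locales
  have coords: "x = (x \<bullet> d) *\<^sub>R d + (x \<bullet> perp d) *\<^sub>R perp d" for x
  proof -
    obtain i j where x: "x = pt i j" by (rule pt_cases)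
    have "d \<bullet> d = 1" "perp d \<bullet> perp d = 1" "d \<bullet> perp d = 0" "perp d \<bullet> d = 0"
      using unit_squares by (simp_all add: inner_vec_def sum_2 power2_eq_square)
    then show ?thesis by (simp add: x pt_def inner_add_left)
  qed
  have "norm v * (w \<bullet> d) = norm w * (v \<bullet> d)"
  proof -
    have "norm v * (w \<bullet> e) = norm w * (v \<bullet> e)"
      by (simp add: e_def inner_add_right inner_commute[of w v] power2_norm_eq_inner[symmetric])
        (simp add: algebra_simps power2_eq_square)
    then show ?thesis by (simp add: d_def)
  qed
  moreover have "norm v * (w \<bullet> perp d) = - norm w * (v \<bullet> perp d)"
  proof -
    have "e \<bullet> perp e = 0" by (simp add: inner_vec_def sum_2)
    moreover have "perp d = (1 / norm e) *\<^sub>R perp e" by (simp add: d_def vec2_eq_iff)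
    ultimately have "e \<bullet> perp d = 0" by simp
    then show ?thesis by (simp add: e_def inner_add_left)
  qed
  ultimately have "w \<bullet> d = (norm w / norm v) * (v \<bullet> d)" "w \<bullet> perp d = - (norm w / norm v) * (v \<bullet> perp d)"
    using assms by (simp_all add: field_simps)
  then have "w = (norm w / norm v) *\<^sub>R ((v \<bullet> d) *\<^sub>R d - (v \<bullet> perp d) *\<^sub>R perp d)"
    using coords[of w] by (simp add: scaleR_right_diff_distrib)
  with \<open>norm d = 1\<close> coords[of v] show thesis by (rule that)
qed

text \<open>\<open>A\<close> is the meeting point of lines from antipodal points in mirrored
  directions. The equations imply \<open>a * b = f * g\<close> if \<open>p * q \<noteq> 0\<close>;
  left undivided, they also cover directions along an axis.\<close>

lemma (in orthonormal_frame) pt_from_directions: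
  assumes "pt f g + x *\<^sub>R (p *\<^sub>R d + q *\<^sub>R perp d) = A" "pt (- f) (- g) + y *\<^sub>R (p *\<^sub>R d - q *\<^sub>R perp d) = A"
  obtains a b where "A = pt a b" "a * q = - g * p" "b * p = - f * q"
proof
  have 1: "A = pt (f + x * p) (g + x * q)"
    unfolding assms(1)[symmetric] pt_def by (simp add: algebra_simps)
  then show "A = pt (f + x * p) (g + x * q)" .
  have "A = pt (- f + y * p) (- g - y * q)"
    unfolding assms(2)[symmetric] pt_def by (simp add: algebra_simps)
  then have eqs: "f + x * p = - f + y * p" "g + x * q = - g - y * q"
    unfolding 1 pt_eq_iff by auto
  have "2 * ((f + x * p) * q) = 2 * (- g * p)" "2 * ((g + x * q) * p) = 2 * (- f * q)"
    using eqs by algebra+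
  then show "(f + x * p) * q = - g * p" "(g + x * q) * p = - f * q" by (simp_all add: mult.commute)
qed

section \<open>Turned directions and degenerate frames\<close>

text \<open>\<open>(p', q')\<close> is \<open>(p, q)\<close> rotated by 120 degrees, in the sense given by the sign of \<open>h = \<plusminus> sqrt 3 / 2\<close>.\<close>

definition turned :: "real \<Rightarrow> real \<Rightarrow> real \<Rightarrow> real \<Rightarrow> real \<Rightarrow> bool" where
  "turned h p q p' q' \<longleftrightarrow> 2 * p' = - p - 2 * h * q \<and> 2 * q' = 2 * h * p - q"

lemma turned_cycle:
  assumes "4 * h\<^sup>2 = 3" "turned h p\<^sub>0 q\<^sub>0 p\<^sub>1 q\<^sub>1" "turned h p\<^sub>1 q\<^sub>1 p\<^sub>2 q\<^sub>2"
  shows "turned h p\<^sub>2 q\<^sub>2 p\<^sub>0 q\<^sub>0"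
proof -
  have hh: "h * (h * x) = 3 / 4 * x" for x
    using assms(1) by (simp add: power2_eq_square flip: mult.assoc)
  have 1: "p\<^sub>1 = - p\<^sub>0 / 2 - h * q\<^sub>0" "q\<^sub>1 = h * p\<^sub>0 - q\<^sub>0 / 2"
    using assms(2) by (auto simp: turned_def)
  have 2: "p\<^sub>2 = - p\<^sub>1 / 2 - h * q\<^sub>1" "q\<^sub>2 = h * p\<^sub>1 - q\<^sub>1 / 2"
    using assms(3) by (auto simp: turned_def)
  show ?thesis
    unfolding turned_def 2 1 by (simp add: algebra_simps hh) argo
qed

text \<open>The other two directions are mirror images in the second axis, so their vertices are
  \<open>(\<plusminus> 2 * g * h, 0)\<close>, equidistant from the remaining vertex
  \<open>(0, b\<^sub>0)\<close>.\<close>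

lemma isosceles_if_vertex_on_axis:
  fixes h g :: real
  assumes "4 * h\<^sup>2 = 3" "turned h p\<^sub>0 q\<^sub>0 p\<^sub>1 q\<^sub>1" "turned h p\<^sub>1 q\<^sub>1 p\<^sub>2 q\<^sub>2"
    and "p\<^sub>0 = 0" "q\<^sub>0 \<noteq> 0"
    and "a\<^sub>0 * q\<^sub>0 = - g * p\<^sub>0" "a\<^sub>1 * q\<^sub>1 = - g * p\<^sub>1" "a\<^sub>2 * q\<^sub>2 = - g * p\<^sub>2" "b\<^sub>1 * p\<^sub>1 = 0" "b\<^sub>2 * p\<^sub>2 = 0"
  shows "(a\<^sub>0 - a\<^sub>1)\<^sup>2 + (b\<^sub>0 - b\<^sub>1)\<^sup>2 = (a\<^sub>2 - a\<^sub>0)\<^sup>2 + (b\<^sub>2 - b\<^sub>0)\<^sup>2"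
proof -
  have "h \<noteq> 0" using assms(1) by auto
  have p: "p\<^sub>1 = - h * q\<^sub>0" "q\<^sub>1 = - q\<^sub>0 / 2" using assms by (auto simp: turned_def)
  have "q\<^sub>2 = - q\<^sub>0 / 2" "p\<^sub>2 = - 2 * h * q\<^sub>2"
  proof -
    have eqs: "p\<^sub>2 = - 2 * h * q\<^sub>2" "2 * q\<^sub>0 = 2 * h * p\<^sub>2 - q\<^sub>2"
      using turned_cycle[OF assms(1-3)] \<open>p\<^sub>0 = 0\<close> by (auto simp: turned_def)
    then show "p\<^sub>2 = - 2 * h * q\<^sub>2" by blast
    have "2 * q\<^sub>0 = - (4 * h\<^sup>2) * q\<^sub>2 - q\<^sub>2"
      using eqs by (simp add: power2_eq_square)
    then show "q\<^sub>2 = - q\<^sub>0 / 2" unfolding assms(1) by simp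
  qed
  then have p2: "p\<^sub>2 = h * q\<^sub>0" "q\<^sub>2 = - q\<^sub>0 / 2" by auto
  have "b\<^sub>1 = 0" "b\<^sub>2 = 0" "a\<^sub>0 = 0"
    using assms p p2 \<open>h \<noteq> 0\<close> by auto
  moreover have "a\<^sub>1 = - 2 * g * h" "a\<^sub>2 = 2 * g * h"
  proof -
    have "(a\<^sub>1 + 2 * g * h) * q\<^sub>0 = 0" "(a\<^sub>2 - 2 * g * h) * q\<^sub>0 = 0"
      using assms(7,8) unfolding p p2 by (simp_all add: algebra_simps)
    with \<open>q\<^sub>0 \<noteq> 0\<close> show "a\<^sub>1 = - 2 * g * h" "a\<^sub>2 = 2 * g * h" by auto
  qed
  ultimately show ?thesis by simp
qed

text \<open>If \<open>F\<^sub>1F\<^sub>2\<close> is parallel to an asymptote, the conic splits into the two axes of the frame.\<close>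

lemma degenerate_frame_impossible:
  fixes h g :: real
  assumes h: "4 * h\<^sup>2 = 3" and t: "turned h p\<^sub>0 q\<^sub>0 p\<^sub>1 q\<^sub>1" "turned h p\<^sub>1 q\<^sub>1 p\<^sub>2 q\<^sub>2"
    and "g \<noteq> 0" "p\<^sub>0 \<noteq> 0 \<or> q\<^sub>0 \<noteq> 0"
    and a: "a\<^sub>0 * q\<^sub>0 = - g * p\<^sub>0" "a\<^sub>1 * q\<^sub>1 = - g * p\<^sub>1" "a\<^sub>2 * q\<^sub>2 = - g * p\<^sub>2"
    and b: "b\<^sub>0 * p\<^sub>0 = 0" "b\<^sub>1 * p\<^sub>1 = 0" "b\<^sub>2 * p\<^sub>2 = 0"
    and off: "\<not> (b\<^sub>0 = 0 \<and> b\<^sub>1 = 0 \<and> b\<^sub>2 = 0)"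
    and sides: "(a\<^sub>0 - a\<^sub>1)\<^sup>2 + (b\<^sub>0 - b\<^sub>1)\<^sup>2 \<noteq> (a\<^sub>1 - a\<^sub>2)\<^sup>2 + (b\<^sub>1 - b\<^sub>2)\<^sup>2"
      "(a\<^sub>1 - a\<^sub>2)\<^sup>2 + (b\<^sub>1 - b\<^sub>2)\<^sup>2 \<noteq> (a\<^sub>2 - a\<^sub>0)\<^sup>2 + (b\<^sub>2 - b\<^sub>0)\<^sup>2"
      "(a\<^sub>2 - a\<^sub>0)\<^sup>2 + (b\<^sub>2 - b\<^sub>0)\<^sup>2 \<noteq> (a\<^sub>0 - a\<^sub>1)\<^sup>2 + (b\<^sub>0 - b\<^sub>1)\<^sup>2"
  shows False
proof -
  have t0: "turned h p\<^sub>2 q\<^sub>2 p\<^sub>0 q\<^sub>0" using h t by (rule turned_cycle)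
  have ne1: "p\<^sub>1 \<noteq> 0 \<or> q\<^sub>1 \<noteq> 0" and ne2: "p\<^sub>2 \<noteq> 0 \<or> q\<^sub>2 \<noteq> 0"
    using t t0 assms(5) by (auto simp: turned_def)
  \<comment> \<open>Some \<open>b\<close> is nonzero, so the corresponding \<open>p\<close>
    vanishes.\<close>
  consider "p\<^sub>0 = 0" | "p\<^sub>1 = 0" | "p\<^sub>2 = 0" using off b by auto
  then show False
  proof cases
    case 1
    then show False
      using isosceles_if_vertex_on_axis[OF h t, of a\<^sub>0 g a\<^sub>1 a\<^sub>2 b\<^sub>1 b\<^sub>2 b\<^sub>0] assms by auto
  next
    case 2
    then show False
      using isosceles_if_vertex_on_axis[OF h t(2) t0, of a\<^sub>1 g a\<^sub>2 a\<^sub>0 b\<^sub>2 b\<^sub>0 b\<^sub>1] assms ne1 by auto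
  next
    case 3
    then show False
      using isosceles_if_vertex_on_axis[OF h t0 t(1), of a\<^sub>2 g a\<^sub>0 a\<^sub>1 b\<^sub>0 b\<^sub>1 b\<^sub>2] assms ne2 by auto
  qed
qed

text \<open>\<open>- p / q\<close> is the tangent of the direction angle plus 90 degrees, and
  \<open>- 2 * h\<close> is the tangent of the 120 degree turn.\<close>

lemma turned_tan_step:
  assumes "turned h p q p' q'" "q \<noteq> 0" "q' \<noteq> 0"
  shows "- p' / q' - - p / q = (- 2 * h) * (1 + (- p / q) * (- p' / q'))"
proof -
  have "2 * (p * q' - p' * q) = 2 * ((- 2 * h) * (q * q' + p * p'))"
    using assms(1) unfolding turned_def by algebra
  then show ?thesis using assms(2,3) by (simp add: field_simps)
qed

lemma orient_eq_0_imp_collinear: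
  assumes "orient A B C = 0"
  shows "collinear {A, B, C}"
proof (cases "A = B")
  case False
  then show ?thesis
    using in_affine_hull_iff_orient assms by (simp add: collinear_3_affine_hull)
qed simp

text \<open>Each vertex is the intersection of its lines to the two Fermat points, whose directions
  are mirrored in the frame. It therefore has parameter \<open>- p / q\<close>, and the 120 degree
  turns make these parameters a triple.\<close>

lemma kiepert_frame:
  assumes sc: "scalene_triangle A B C"
    and F1: "first_fermat_point A B C F\<^sub>1" and F2: "second_fermat_point A B C F\<^sub>2" and "F\<^sub>1 \<noteq> F\<^sub>2"
  obtains M d f g s a b c where "rectangular_hyperbola d f g" "s\<^sup>2 = 3" "tan_triple s a b c"
    "a \<noteq> 0" "b \<noteq> 0" "c \<noteq> 0"
    "A = rectangular_hyperbola.hpt M d f g a" "B = rectangular_hyperbola.hpt M d f g b"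
    "C = rectangular_hyperbola.hpt M d f g c"
    "F\<^sub>1 = rectangular_hyperbola.hpt M d f g (f / g)" "F\<^sub>2 = rectangular_hyperbola.hpt M d f g (- (f / g))"
proof -
  have "orient A B C \<noteq> 0"
    using sc orient_eq_0_imp_collinear by (auto simp: scalene_triangle_def)
  \<comment> \<open>The sign makes \<open>erected h\<close> point inward and
    \<open>erected (- h)\<close> outward on every side.\<close>
  define h where "h = sgn (orient A B C) * (sqrt 3 / 2)"
  have h2: "h\<^sup>2 = 3 / 4" and h4: "4 * h\<^sup>2 = 3"
    using \<open>orient A B C \<noteq> 0\<close> by (auto simp: h_def power_mult_distrib power_divide sgn_if)
  have ho: "h * orient A B C > 0"
    using \<open>orient A B C \<noteq> 0\<close> by (auto simp: h_def sgn_if mult_less_0_iff)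
  then have ho': "h * orient B C A > 0" "h * orient C A B > 0"
    by (simp_all add: orient_rotate)
  have h2': "(- h)\<^sup>2 = 3 / 4" using h2 by simp
  define v w where "v = erected (- h) B C - A" and "w = erected h B C - A"
  have "v \<noteq> 0" "w \<noteq> 0"
    unfolding v_def w_def using erected_ne_opposite_vertex[OF sc] by blast+
  then obtain d p\<^sub>0 q\<^sub>0 r where d: "norm d = 1" and v: "v = p\<^sub>0 *\<^sub>R d + q\<^sub>0 *\<^sub>R perp d"
    and w: "w = r *\<^sub>R (p\<^sub>0 *\<^sub>R d - q\<^sub>0 *\<^sub>R perp d)"
    by (rule exists_bisecting_frame)
  define M where "M = (1/2) *\<^sub>R (F\<^sub>1 + F\<^sub>2)"
  interpret orthonormal_frame M d using d by unfold_locales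
  define p\<^sub>1 q\<^sub>1 where "p\<^sub>1 = - p\<^sub>0 / 2 - h * q\<^sub>0" and "q\<^sub>1 = h * p\<^sub>0 - q\<^sub>0 / 2"
  define p\<^sub>2 q\<^sub>2 where "p\<^sub>2 = - p\<^sub>1 / 2 - h * q\<^sub>1" and "q\<^sub>2 = h * p\<^sub>1 - q\<^sub>1 / 2"
  have t: "turned h p\<^sub>0 q\<^sub>0 p\<^sub>1 q\<^sub>1" "turned h p\<^sub>1 q\<^sub>1 p\<^sub>2 q\<^sub>2"
    by (auto simp: turned_def p\<^sub>1_def q\<^sub>1_def p\<^sub>2_def q\<^sub>2_def algebra_simps diff_divide_distrib add_divide_distrib)
  \<comment> \<open>The turns by \<open>- h\<close> and by \<open>h\<close> change
    \<open>(p, q)\<close> in the same way, because the inner directions are mirrored.\<close>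
  have rot: "(- 1/2) *\<^sub>R (p *\<^sub>R d + q *\<^sub>R perp d) - (- h) *\<^sub>R perp (p *\<^sub>R d + q *\<^sub>R perp d)
      = (- p / 2 - h * q) *\<^sub>R d + (h * p - q / 2) *\<^sub>R perp d"
    "(- 1/2) *\<^sub>R (r *\<^sub>R (p *\<^sub>R d - q *\<^sub>R perp d)) - h *\<^sub>R perp (r *\<^sub>R (p *\<^sub>R d - q *\<^sub>R perp d))
      = r *\<^sub>R ((- p / 2 - h * q) *\<^sub>R d - (h * p - q / 2) *\<^sub>R perp d)" for p q
    by (simp_all add: vec2_eq_iff algebra_simps)
  have outer: "erected (- h) B C - A = p\<^sub>0 *\<^sub>R d + q\<^sub>0 *\<^sub>R perp d"
    "erected (- h) C A - B = p\<^sub>1 *\<^sub>R d + q\<^sub>1 *\<^sub>R perp d"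
    "erected (- h) A B - C = p\<^sub>2 *\<^sub>R d + q\<^sub>2 *\<^sub>R perp d"
  proof -
    show 0: "erected (- h) B C - A = p\<^sub>0 *\<^sub>R d + q\<^sub>0 *\<^sub>R perp d" using v v_def by simp
    show 1: "erected (- h) C A - B = p\<^sub>1 *\<^sub>R d + q\<^sub>1 *\<^sub>R perp d"
      using erected_direction_rotate[OF h2' 0] unfolding rot p\<^sub>1_def q\<^sub>1_def .
    show "erected (- h) A B - C = p\<^sub>2 *\<^sub>R d + q\<^sub>2 *\<^sub>R perp d"
      using erected_direction_rotate[OF h2' 1] unfolding rot p\<^sub>2_def q\<^sub>2_def .
  qed
  have inner: "erected h B C - A = r *\<^sub>R (p\<^sub>0 *\<^sub>R d - q\<^sub>0 *\<^sub>R perp d)"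
    "erected h C A - B = r *\<^sub>R (p\<^sub>1 *\<^sub>R d - q\<^sub>1 *\<^sub>R perp d)"
    "erected h A B - C = r *\<^sub>R (p\<^sub>2 *\<^sub>R d - q\<^sub>2 *\<^sub>R perp d)"
  proof -
    show 0: "erected h B C - A = r *\<^sub>R (p\<^sub>0 *\<^sub>R d - q\<^sub>0 *\<^sub>R perp d)" using w w_def by simp
    show 1: "erected h C A - B = r *\<^sub>R (p\<^sub>1 *\<^sub>R d - q\<^sub>1 *\<^sub>R perp d)"
      using erected_direction_rotate[OF h2 0] unfolding rot p\<^sub>1_def q\<^sub>1_def .
    show "erected h A B - C = r *\<^sub>R (p\<^sub>2 *\<^sub>R d - q\<^sub>2 *\<^sub>R perp d)"
      using erected_direction_rotate[OF h2 1] unfolding rot p\<^sub>2_def q\<^sub>2_def .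
  qed
  have hull1: "F\<^sub>1 \<in> affine hull {A, erected (- h) B C}" "F\<^sub>1 \<in> affine hull {B, erected (- h) C A}"
    "F\<^sub>1 \<in> affine hull {C, erected (- h) A B}"
    using F1 outer_apex_eq_erected[OF _ h2 ho] outer_apex_eq_erected[OF _ h2 ho'(1)]
      outer_apex_eq_erected[OF _ h2 ho'(2)]
    unfolding first_fermat_point_def by blast+
  have hull2: "F\<^sub>2 \<in> affine hull {A, erected h B C}" "F\<^sub>2 \<in> affine hull {B, erected h C A}"
    "F\<^sub>2 \<in> affine hull {C, erected h A B}"
    using F2 inner_apex_eq_erected[OF _ h2 ho] inner_apex_eq_erected[OF _ h2 ho'(1)]
      inner_apex_eq_erected[OF _ h2 ho'(2)]
    unfolding second_fermat_point_def by blast+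
  obtain f g where F1_eq: "F\<^sub>1 = pt f g" by (rule pt_cases)
  have "F\<^sub>2 = 2 *\<^sub>R M - F\<^sub>1" by (simp add: M_def scaleR_2)
  also have "\<dots> = pt (- f) (- g)" unfolding F1_eq by (simp add: pt_def scaleR_2)
  finally have F2_eq: "F\<^sub>2 = pt (- f) (- g)" .
  have vertex: "\<exists>a b. X = pt a b \<and> a * q = - g * p \<and> b * p = - f * q"
    if hulls: "F\<^sub>1 \<in> affine hull {X, Y}" "F\<^sub>2 \<in> affine hull {X, Z}"
      and dirs: "Y - X = p *\<^sub>R d + q *\<^sub>R perp d" "Z - X = r *\<^sub>R (p *\<^sub>R d - q *\<^sub>R perp d)" for X Y Z p q
  proof -
    obtain x where x: "F\<^sub>1 + x *\<^sub>R (Y - X) = X" using hulls(1) by (rule affine_hull_pair_offset)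
    obtain y where y: "F\<^sub>2 + y *\<^sub>R (Z - X) = X" using hulls(2) by (rule affine_hull_pair_offset)
    have "pt f g + x *\<^sub>R (p *\<^sub>R d + q *\<^sub>R perp d) = X"
      "pt (- f) (- g) + (y * r) *\<^sub>R (p *\<^sub>R d - q *\<^sub>R perp d) = X"
      using x y unfolding F1_eq F2_eq dirs by simp_all
    then show ?thesis by (rule pt_from_directions) blast
  qed
  obtain a\<^sub>0 b\<^sub>0 where A: "A = pt a\<^sub>0 b\<^sub>0" "a\<^sub>0 * q\<^sub>0 = - g * p\<^sub>0" "b\<^sub>0 * p\<^sub>0 = - f * q\<^sub>0"
    using vertex[OF hull1(1) hull2(1) outer(1) inner(1)] by blast
  obtain a\<^sub>1 b\<^sub>1 where B: "B = pt a\<^sub>1 b\<^sub>1" "a\<^sub>1 * q\<^sub>1 = - g * p\<^sub>1" "b\<^sub>1 * p\<^sub>1 = - f * q\<^sub>1"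
    using vertex[OF hull1(2) hull2(2) outer(2) inner(2)] by blast
  obtain a\<^sub>2 b\<^sub>2 where C: "C = pt a\<^sub>2 b\<^sub>2" "a\<^sub>2 * q\<^sub>2 = - g * p\<^sub>2" "b\<^sub>2 * p\<^sub>2 = - f * q\<^sub>2"
    using vertex[OF hull1(3) hull2(3) outer(3) inner(3)] by blast
  have ne0: "p\<^sub>0 \<noteq> 0 \<or> q\<^sub>0 \<noteq> 0" using v \<open>v \<noteq> 0\<close> by auto
  have t0: "turned h p\<^sub>2 q\<^sub>2 p\<^sub>0 q\<^sub>0" using h4 t by (rule turned_cycle)
  have ne1: "p\<^sub>1 \<noteq> 0 \<or> q\<^sub>1 \<noteq> 0" and ne2: "p\<^sub>2 \<noteq> 0 \<or> q\<^sub>2 \<noteq> 0"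
    using t t0 ne0 by (auto simp: turned_def)
  have sides: "(a\<^sub>0 - a\<^sub>1)\<^sup>2 + (b\<^sub>0 - b\<^sub>1)\<^sup>2 \<noteq> (a\<^sub>1 - a\<^sub>2)\<^sup>2 + (b\<^sub>1 - b\<^sub>2)\<^sup>2"
      "(a\<^sub>1 - a\<^sub>2)\<^sup>2 + (b\<^sub>1 - b\<^sub>2)\<^sup>2 \<noteq> (a\<^sub>2 - a\<^sub>0)\<^sup>2 + (b\<^sub>2 - b\<^sub>0)\<^sup>2"
      "(a\<^sub>2 - a\<^sub>0)\<^sup>2 + (b\<^sub>2 - b\<^sub>0)\<^sup>2 \<noteq> (a\<^sub>0 - a\<^sub>1)\<^sup>2 + (b\<^sub>0 - b\<^sub>1)\<^sup>2"
    using sc unfolding scalene_triangle_def A(1) B(1) C(1) dist_eq_iff_squared dist_pt_squared by auto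
  have ncol: "\<not> collinear {A, B, C}" using sc by (simp add: scalene_triangle_def)
  have fg: "f \<noteq> 0 \<or> g \<noteq> 0" using \<open>F\<^sub>1 \<noteq> F\<^sub>2\<close> F1_eq F2_eq by auto
  have "f \<noteq> 0"
  proof
    assume "f = 0"
    have "\<not> (b\<^sub>0 = 0 \<and> b\<^sub>1 = 0 \<and> b\<^sub>2 = 0)"
      using ncol collinear_pt_axis A(1) B(1) C(1) by auto
    then show False
      using degenerate_frame_impossible[OF h4 t _ ne0 A(2) B(2) C(2), of b\<^sub>0 b\<^sub>1 b\<^sub>2] A(3) B(3) C(3)
        fg sides \<open>f = 0\<close> by simp
  qed
  have "g \<noteq> 0"
  proof
    assume "g = 0"
    \<comment> \<open>A quarter turn exchanges the axes: \<open>f\<close>, \<open>- b\<close>,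
      \<open>a\<close> take the roles of \<open>g\<close>, \<open>a\<close>,
      \<open>b\<close>.\<close>
    interpret quarter: orthonormal_frame M "perp d"
    proof
      have "(norm (perp d))\<^sup>2 = 1"
        using dist_vec2_squared[of "perp d" 0] unit_squares by simp
      then show "norm (perp d) = 1" using norm_ge_zero[of "perp d"] by (auto simp: power2_eq_1_iff)
    qed
    have "pt 0 y = quarter.pt y 0" for y by (simp add: pt_def quarter.pt_def)
    then have "\<not> (a\<^sub>0 = 0 \<and> a\<^sub>1 = 0 \<and> a\<^sub>2 = 0)"
      using ncol quarter.collinear_pt_axis A(1) B(1) C(1) by auto
    moreover have "turned h q\<^sub>0 (- p\<^sub>0) q\<^sub>1 (- p\<^sub>1)" "turned h q\<^sub>1 (- p\<^sub>1) q\<^sub>2 (- p\<^sub>2)"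
      using t by (auto simp: turned_def)
    ultimately show False
      using degenerate_frame_impossible[OF h4, of q\<^sub>0 "- p\<^sub>0" q\<^sub>1 "- p\<^sub>1" q\<^sub>2 "- p\<^sub>2" f "- b\<^sub>0" "- b\<^sub>1" "- b\<^sub>2" a\<^sub>0 a\<^sub>1 a\<^sub>2]
        A(2,3) B(2,3) C(2,3) fg sides ne0 \<open>g = 0\<close>
      by (simp add: add.commute power2_commute) blast
  qed
  interpret rectangular_hyperbola M d f g
    using \<open>f \<noteq> 0\<close> \<open>g \<noteq> 0\<close> by unfold_locales
  have nz: "p\<^sub>0 \<noteq> 0" "q\<^sub>0 \<noteq> 0" "p\<^sub>1 \<noteq> 0" "q\<^sub>1 \<noteq> 0" "p\<^sub>2 \<noteq> 0" "q\<^sub>2 \<noteq> 0"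
    using A B C ne0 ne1 ne2 f_nz g_nz by auto
  have on_hyp: "pt x y = hpt (- p / q)" if "x * q = - g * p" "y * p = - f * q" "p \<noteq> 0" "q \<noteq> 0" for x y p q
    using that by (simp add: hpt_def pt_eq_iff field_simps)
  show thesis
  proof (rule that)
    show "rectangular_hyperbola d f g" by unfold_locales
    show "(- 2 * h)\<^sup>2 = 3" using h4 by (simp add: power_mult_distrib)
    show "tan_triple (- 2 * h) (- p\<^sub>0 / q\<^sub>0) (- p\<^sub>1 / q\<^sub>1) (- p\<^sub>2 / q\<^sub>2)"
      unfolding tan_triple_def
      using turned_tan_step[OF t(1)] turned_tan_step[OF t(2)] turned_tan_step[OF t0] nz by blast
    show "- p\<^sub>0 / q\<^sub>0 \<noteq> 0" "- p\<^sub>1 / q\<^sub>1 \<noteq> 0" "- p\<^sub>2 / q\<^sub>2 \<noteq> 0" using nz by auto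
    show "A = hpt (- p\<^sub>0 / q\<^sub>0)" "B = hpt (- p\<^sub>1 / q\<^sub>1)" "C = hpt (- p\<^sub>2 / q\<^sub>2)"
      using A B C nz on_hyp by auto
    show "F\<^sub>1 = hpt (f / g)" "F\<^sub>2 = hpt (- (f / g))"
      using f_nz g_nz by (auto simp: F1_eq F2_eq hpt_def)
  qed
qed

theorem theorem1:
  fixes A B C F\<^sub>1 F\<^sub>2 :: "real^2" and K :: "(real^2) set"
  assumes "scalene_triangle A B C"
    and "first_fermat_point A B C F\<^sub>1"
    and "second_fermat_point A B C F\<^sub>2"
    and "kiepert_hyperbola A B C F\<^sub>1 F\<^sub>2 K"
    and "card (sphere F\<^sub>2 (dist F\<^sub>2 F\<^sub>1) \<inter> K - {F\<^sub>1}) = 3"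
    and "card (sphere F\<^sub>1 (dist F\<^sub>2 F\<^sub>1) \<inter> K - {F\<^sub>2}) = 3"
  shows "\<exists>P Q R P' Q' R'.
      {P, Q, R} = sphere F\<^sub>2 (dist F\<^sub>2 F\<^sub>1) \<inter> K - {F\<^sub>1} \<and>
      {P', Q', R'} = sphere F\<^sub>1 (dist F\<^sub>2 F\<^sub>1) \<inter> K - {F\<^sub>2} \<and>
      equilateral_triangle P Q R \<and> equilateral_triangle P' Q' R' \<and>
      (\<exists>P\<^sub>1 P\<^sub>2 P\<^sub>3 P\<^sub>1' P\<^sub>2' P\<^sub>3'.
         perspector P Q R A B C P\<^sub>1 \<and>
         perspector P Q R B C A P\<^sub>2 \<and>
         perspector P Q R C A B P\<^sub>3 \<and>
         perspector P' R' Q' A B C P\<^sub>1' \<and>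
         perspector P' R' Q' B C A P\<^sub>2' \<and>
         perspector P' R' Q' C A B P\<^sub>3' \<and>
         (\<exists>L. proj_line L \<and> P\<^sub>1 \<subseteq> L \<and> P\<^sub>2 \<subseteq> L \<and> P\<^sub>3 \<subseteq> L \<and>
              P\<^sub>1' \<subseteq> L \<and> P\<^sub>2' \<subseteq> L \<and> P\<^sub>3' \<subseteq> L))"
proof -
  have dist5: "distinct [A, B, C, F\<^sub>1, F\<^sub>2]" and con: "conic K" and sub: "{A, B, C, F\<^sub>1, F\<^sub>2} \<subseteq> K"
    using assms(4) by (auto simp: kiepert_hyperbola_def)
  then have "F\<^sub>1 \<noteq> F\<^sub>2" by simp
  then obtain M d f g s a b c where hyp: "rectangular_hyperbola d f g" and s: "s\<^sup>2 = 3"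
    and T: "tan_triple s a b c" and nz: "a \<noteq> 0" "b \<noteq> 0" "c \<noteq> 0"
    and pts: "A = rectangular_hyperbola.hpt M d f g a" "B = rectangular_hyperbola.hpt M d f g b"
      "C = rectangular_hyperbola.hpt M d f g c" "F\<^sub>1 = rectangular_hyperbola.hpt M d f g (f / g)"
      "F\<^sub>2 = rectangular_hyperbola.hpt M d f g (- (f / g))"
    using kiepert_frame[OF assms(1-3)] by metis
  interpret rectangular_hyperbola M d f g by (rule hyp)
  have s0: "s \<noteq> 0" "- s \<noteq> 0" and s': "(- s)\<^sup>2 = 3" using s by auto
  have K: "K = hpt ` (- {0})"
  proof (rule conic_eq_hyperbola[OF con])
    show "hpt ` {a, b, c, f / g, - (f / g)} \<subseteq> K" using sub pts by simp
    show "0 \<notin> {a, b, c, f / g, - (f / g)}" using nz f_nz g_nz by auto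
    show "card {a, b, c, f / g, - (f / g)} = 5"
      using dist5 unfolding pts distinct.simps list.set by (simp add: hpt_eq_iff)
  qed
  \<comment> \<open>A product \<open>\<plusminus> f / g\<close> would make the scalene triangle
    equilateral; this keeps its parameters disjoint from those on the circles.\<close>
  have not_equi: "a * b * c \<noteq> f / g" "a * b * c \<noteq> - (f / g)"
    using tan_triple_equilateral[OF T s] assms(1)
    unfolding pts scalene_triangle_def equilateral_triangle_def by auto
  have L: "\<exists>X\<^sub>1 X\<^sub>2 X\<^sub>3.
      perspector (hpt x) (hpt y) (hpt z) A B C X\<^sub>1 \<and>
      perspector (hpt x) (hpt y) (hpt z) B C A X\<^sub>2 \<and>
      perspector (hpt x) (hpt y) (hpt z) C A B X\<^sub>3 \<and>
      X\<^sub>1 \<union> X\<^sub>2 \<union> X\<^sub>3 \<subseteq> span {axis_vec 1 0, axis_vec 0 1}"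
    if xyz: "tan_triple (- s) x y z" "x * y * z = f / g \<or> x * y * z = - (f / g)" for x y z
  proof -
    have "x * y * z \<noteq> 0" "x * y * z \<noteq> a * b * c" using xyz(2) not_equi f_nz g_nz by auto
    then have "{x, y, z} \<inter> {a, b, c} = {}" "0 \<notin> {x, y, z} \<union> {a, b, c}"
      using tan_triple_disjoint[OF xyz(1) T s0(2,1)] nz by auto
    then show ?thesis
      unfolding pts using triply_perspective[OF xyz(1)] T by (metis minus_minus)
  qed
  have k: "f / g = f / g \<or> f / g = - (f / g)" "- (f / g) = f / g \<or> - (f / g) = - (f / g)" by auto
  \<comment> \<open>\<open>k = f / g\<close> is the circle about \<open>F\<^sub>2\<close>; the step
    \<open>- s\<close> orders its triple in the sense opposite to \<open>A\<close>,
    \<open>B\<close>, \<open>C\<close>.\<close>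
  obtain x y z where x: "tan_triple (- s) x y z" "x * y * z = f / g"
    and S: "{hpt x, hpt y, hpt z} = sphere F\<^sub>2 (dist F\<^sub>2 F\<^sub>1) \<inter> K - {F\<^sub>1}"
    using sphere_Int_hyperbola[OF K k(1) s'] assms(5) unfolding pts
    by (metis dist_commute)
  obtain x' y' z' where x': "tan_triple (- s) x' y' z'" "x' * y' * z' = - (f / g)"
    and S': "{hpt x', hpt y', hpt z'} = sphere F\<^sub>1 (dist F\<^sub>2 F\<^sub>1) \<inter> K - {F\<^sub>2}"
    using sphere_Int_hyperbola[OF K k(2) s'] assms(6) unfolding pts
    by (metis minus_minus)
  have E: "equilateral_triangle (hpt x) (hpt y) (hpt z)" "equilateral_triangle (hpt x') (hpt y') (hpt z')"
    using tan_triple_equilateral[OF x(1) s'] tan_triple_equilateral[OF x'(1) s'] x x' by auto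
  then have E': "equilateral_triangle (hpt x') (hpt z') (hpt y')"
    by (simp add: equilateral_triangle_def dist_commute insert_commute)
  obtain X\<^sub>1 X\<^sub>2 X\<^sub>3 where X: "perspector (hpt x) (hpt y) (hpt z) A B C X\<^sub>1"
    "perspector (hpt x) (hpt y) (hpt z) B C A X\<^sub>2" "perspector (hpt x) (hpt y) (hpt z) C A B X\<^sub>3"
    "X\<^sub>1 \<union> X\<^sub>2 \<union> X\<^sub>3 \<subseteq> span {axis_vec 1 0, axis_vec 0 1}"
    using L[OF x(1)] x(2) by auto
  obtain Y\<^sub>1 Y\<^sub>2 Y\<^sub>3 where Y: "perspector (hpt x') (hpt y') (hpt z') A B C Y\<^sub>1"
    "perspector (hpt x') (hpt y') (hpt z') B C A Y\<^sub>2" "perspector (hpt x') (hpt y') (hpt z') C A B Y\<^sub>3"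
    "Y\<^sub>1 \<union> Y\<^sub>2 \<union> Y\<^sub>3 \<subseteq> span {axis_vec 1 0, axis_vec 0 1}"
    using L[OF x'(1)] x'(2) by auto
  have line: "\<exists>L. proj_line L \<and> X\<^sub>1 \<subseteq> L \<and> X\<^sub>2 \<subseteq> L \<and> X\<^sub>3 \<subseteq> L \<and> Y\<^sub>1 \<subseteq> L \<and> Y\<^sub>2 \<subseteq> L \<and> Y\<^sub>3 \<subseteq> L"
    using proj_line_axis X(4) Y(4) by auto
  \<comment> \<open>The triple \<open>x'\<close>, \<open>y'\<close>, \<open>z'\<close> corresponds
    to the order \<open>P'\<close>, \<open>R'\<close>, \<open>Q'\<close>, so the last two points are
    swapped when naming \<open>Q'\<close> and \<open>R'\<close>.\<close>
  have S'': "{hpt x', hpt z', hpt y'} = sphere F\<^sub>1 (dist F\<^sub>2 F\<^sub>1) \<inter> K - {F\<^sub>2}"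
    using S' by (simp add: insert_commute)
  show ?thesis
    by (rule exI[of _ "hpt x"], rule exI[of _ "hpt y"], rule exI[of _ "hpt z"],
        rule exI[of _ "hpt x'"], rule exI[of _ "hpt z'"], rule exI[of _ "hpt y'"])
      (use S S'' E(1) E' X(1-3) Y(1-3) line in blast)
qed

end
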